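(* Let $s,r\ge 0$ be integers and let $x_0,x_1,\dots,x_{\min\{s,r\}}$ be variables. The set of all distinct eigenvalues of the symmetric diagram matrix $A^{s+r,s}$ of size $\binom{s+r}{s}$ with entries in $\{x_0,x_1,\dots,x_{\min\{s,r\}}\}$ is given by $$\sum_{t=0}^{\min\{s,r\}}\left[\sum_{j=0}^{l}(-1)^j\binom{l}{j}\binom{s-l}{t-j}\binom{r-l}{t-j}\right]x_{\min\{s,r\}-t}$$ for all $0\le l\le \min\{s,r\}$.
   Context: Diagrams: fix $s$ and $r$ and a set partition $d^+$ of $\{1,\dots,k\}$ with $s+r$ connected components (blocks), numbered $1,\dots,s+r$. A diagram in $\Omega^{s+r,s}$ is obtained by drawing $d^+$ in a top row and a copy of it in a bottom row, choosing $s$ of the $s+r$ components and joining each chosen component of the top row to its copy in the bottom row. The chosen components are called through classes; each of the other $r$ components is called a horizontal edge. Thus a diagram $d_i\in\Omega^{s+r,s}$ is the same as an $s$-element subset $S_i\subseteq\{1,\dots,s+r\}$ (the positions of the through classes), and $|\Omega^{s+r,s}|=\binom{s+r}{s}$. The matrix $A^{s+r,s}=(a_{ij})$ has rows and columns indexed by $\Omega^{s+r,s}$, with entries $a_{ij}=x_{\min\{s,r\}-f}$, where $f$ is the number of horizontal edges in $d_i$ which are replaced by through classes in $d_j$ and vice versa, i.e. $f=|S_j\setminus S_i|=|S_i\setminus S_j|$. It is called the symmetric diagram matrix. The variables $x_0,\dots,x_{\min\{s,r\}}$ are independent indeterminates (over $\mathbb{C}$). Binomial coefficients $\binom{a}{b}$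 are $0$ when $b<0$ or $b>a$. *)

theory Defs
  imports
    "HOL-Library.Poly_Mapping"
    "HOL-Library.Disjoint_Sets"
    "HOL-Computational_Algebra.Polynomial_Factorial"
    "HOL-Algebra.Algebraic_Closure_Type"
    "Jordan_Normal_Form.Char_Poly"
    Complex_Main
begin

section \<open>Diagrams\<close>

text \<open>
  The set partition \<open>P\<close> is the paper's \<open>d\<^sup>+\<close>; its blocks are the connected components.
  A vertex \<open>i\<close> of the top row is \<open>Inl i\<close>, its copy in the bottom row is \<open>Inr i\<close>, and a diagram
  is the set of its connected components.
\<close>

definition diagram :: "'a set set \<Rightarrow> 'a set set \<Rightarrow> ('a + 'a) set set" where
  "diagram P S = (\<lambda>B. Inl ` B \<union> Inr ` B) ` S \<union> (\<lambda>B. Inl ` B) ` (P - S) \<union> (\<lambda>B. Inr ` B) ` (P - S)"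

definition diagrams :: "nat \<Rightarrow> 'a set set \<Rightarrow> ('a + 'a) set set set" where
  "diagrams s P = {diagram P S | S. S \<subseteq> P \<and> card S = s}"

definition through_classes :: "'a set set \<Rightarrow> ('a + 'a) set set \<Rightarrow> 'a set set" where
  "through_classes P d = {B \<in> P. Inl ` B \<union> Inr ` B \<in> d}"

definition horizontal_edges :: "'a set set \<Rightarrow> ('a + 'a) set set \<Rightarrow> 'a set set" where
  "horizontal_edges P d = {B \<in> P. Inl ` B \<in> d \<and> Inr ` B \<in> d}"

text \<open>
  The number \<open>f\<close>: horizontal edges of \<open>d\<close> that become through classes of \<open>d'\<close>. For two diagrams
  with equally many through classes this is symmetric in \<open>d\<close> and \<open>d'\<close>.
\<close>

definition replaced :: "'a set set \<Rightarrow> ('a + 'a) set set \<Rightarrow> ('a + 'a) set set \<Rightarrow> nat" where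
  "replaced P d d' = card (horizontal_edges P d \<inter> through_classes P d')"

lemma through_classes_diagram:
  assumes "{} \<notin> P" "S \<subseteq> P"
  shows "through_classes P (diagram P S) = S"
proof (intro Set.set_eqI iffI)
  fix B assume "B \<in> through_classes P (diagram P S)"
  then have B: "B \<in> P" "Inl ` B \<union> Inr ` B \<in> diagram P S"
    by (simp_all add: through_classes_def)
  from B(1) assms(1) obtain b where b: "b \<in> B" by (metis ex_in_conv)
  from B(2) consider C where "C \<in> S" "Inl ` B \<union> Inr ` B = Inl ` C \<union> Inr ` C"
    | C where "Inl ` B \<union> Inr ` B = Inl ` C" | C where "Inl ` B \<union> Inr ` B = Inr ` C"
    unfolding diagram_def by (elim UnE imageE) metis+
  then show "B \<in> S"
  proof cases
    case 1
    have "B = {v. Inl v \<in> Inl ` B \<union> Inr ` B}" by auto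
    also have "\<dots> = C" unfolding 1(2) by auto
    finally show ?thesis using 1(1) by simp
  next
    case 2
    have "Inr b \<in> Inl ` B \<union> Inr ` B" using b by simp
    then show ?thesis unfolding 2 by auto
  next
    case 3
    have "Inl b \<in> Inl ` B \<union> Inr ` B" using b by simp
    then show ?thesis unfolding 3 by auto
  qed
next
  fix B assume "B \<in> S"
  then show "B \<in> through_classes P (diagram P S)"
    using assms(2) by (auto simp: through_classes_def diagram_def)
qed

lemma horizontal_edges_diagram:
  assumes "{} \<notin> P" "S \<subseteq> P"
  shows "horizontal_edges P (diagram P S) = P - S"
proof (intro Set.set_eqI iffI)
  fix B assume "B \<in> horizontal_edges P (diagram P S)"
  then have B: "B \<in> P" "Inl ` B \<in> diagram P S"
    by (simp_all add: horizontal_edges_def)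
  from B(1) assms(1) obtain b where b: "b \<in> B" by (metis ex_in_conv)
  from B(2) consider C where "C \<in> S" "Inl ` B = Inl ` C \<union> Inr ` C"
    | C where "C \<in> P - S" "(Inl ` B :: ('a + 'a) set) = Inl ` C"
    | C where "(Inl ` B :: ('a + 'a) set) = Inr ` C"
    unfolding diagram_def by (elim UnE imageE) metis+
  then show "B \<in> P - S"
  proof cases
    case 1
    obtain c where "c \<in> C" using 1(1) assms by (metis ex_in_conv subsetD)
    then have "Inr c \<in> Inl ` C \<union> Inr ` C" by simp
    then show ?thesis unfolding 1(2)[symmetric] by auto
  next
    case 2
    then show ?thesis by (simp add: inj_image_eq_iff)
  next
    case 3
    have "(Inl b :: 'a + 'a) \<in> Inl ` B" using b by simp
    then show ?thesis unfolding 3 by auto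
  qed
next
  fix B assume "B \<in> P - S"
  then show "B \<in> horizontal_edges P (diagram P S)"
    by (simp add: horizontal_edges_def diagram_def)
qed

lemma replaced_diagram:
  assumes "{} \<notin> P" "S \<subseteq> P" "T \<subseteq> P"
  shows "replaced P (diagram P S) (diagram P T) = card (T - S)"
proof -
  have "(P - S) \<inter> T = T - S" using assms by blast
  then show ?thesis
    using assms by (simp add: replaced_def through_classes_diagram horizontal_edges_diagram)
qed


section \<open>The symmetric diagram matrix\<close>

text \<open>Polynomials over the complex numbers in the variables \<open>x\<^sub>0, x\<^sub>1, \<dots>\<close>, and the algebraic
  closure of their field of fractions.\<close>

type_synonym cpoly = "(nat \<Rightarrow>\<^sub>0 nat) \<Rightarrow>\<^sub>0 complex"

type_synonym cpoly_closure = "cpoly fract alg_closure"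

definition indet :: "nat \<Rightarrow> cpoly" where
  "indet i = Poly_Mapping.single (Poly_Mapping.single i 1) 1"

definition to_closure :: "cpoly \<Rightarrow> cpoly_closure" where
  "to_closure p = to_ac (to_fract p)"

text \<open>The list \<open>ds\<close> enumerates the diagrams, i.e. fixes the order of the rows and columns.\<close>

definition diagram_matrix ::
    "nat \<Rightarrow> nat \<Rightarrow> 'a set set \<Rightarrow> ('a + 'a) set set list \<Rightarrow> cpoly mat" where
  "diagram_matrix s r P ds =
     mat (length ds) (length ds) (\<lambda>(i, j). indet (min s r - replaced P (ds ! i) (ds ! j)))"

text \<open>Binomial coefficients that vanish for a negative lower index.\<close>

definition binom :: "int \<Rightarrow> int \<Rightarrow> int" where
  "binom a b = (if 0 \<le> b \<and> b \<le> a then int (nat a choose nat b) else 0)"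

definition diagram_eigenvalue :: "nat \<Rightarrow> nat \<Rightarrow> nat \<Rightarrow> cpoly" where
  "diagram_eigenvalue s r l =
     (\<Sum>t = 0..min s r.
        of_int (\<Sum>j = 0..l. (-1) ^ j * binom (int l) (int j)
                  * binom (int s - int l) (int t - int j) * binom (int r - int l) (int t - int j))
        * indet (min s r - t))"

end

theory Submission
  imports Defs
begin

text \<open>
  A diagram is an \<open>s\<close>-subset of the \<open>s + r\<close> blocks, so the matrix is a generic element
  of the Bose-Mesner algebra of the Johnson scheme. For \<open>l\<close> disjoint pairs \<open>(a\<^sub>i, b\<^sub>i)\<close> of
  blocks, the function \<open>S \<mapsto> \<Prod>\<^sub>i ([a\<^sub>i \<in> S] - [b\<^sub>i \<in> S])\<close> is an eigenvector, and
  the \<open>l\<close>-th eigenvalue is obtained by summing out one pair at a time.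

  Conversely, let \<open>A\<close> be the matrix and \<open>A\<^sub>1\<close> the distance-one matrix, with eigenvalues
  \<open>\<theta>\<^sub>0, \<dots>, \<theta>\<^sub>m\<close> on the above eigenvectors. Multiplication by \<open>A\<^sub>1\<close> acts on the
  \<open>m + 1\<close> distance classes by a tridiagonal operator, whence the distance-\<open>t\<close> matrix is
  a polynomial of degree \<open>t\<close> in \<open>A\<^sub>1\<close>. Since the \<open>\<theta>\<^sub>l\<close> are distinct, this forces
  \<open>\<Prod>\<^sub>l (A\<^sub>1 - \<theta>\<^sub>l) = 0\<close>. Applying these commuting factors one at a time to an
  eigenvector of \<open>A\<close>, the last nonzero vector is an eigenvector of \<open>A\<^sub>1\<close> with some
  eigenvalue \<open>\<theta>\<^sub>l\<close> and still one of \<open>A\<close> with the same eigenvalue, which is therefore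
  the \<open>l\<close>-th one.
\<close>

section \<open>Sums over subsets at prescribed distance\<close>

fun pair_fun :: "('a \<times> 'a) list \<Rightarrow> 'a set \<Rightarrow> 'k::comm_ring_1" where
  "pair_fun [] S = 1"
| "pair_fun ((a, b) # ps) S = (of_bool (a \<in> S) - of_bool (b \<in> S)) * pair_fun ps S"

definition eberlein :: "nat \<Rightarrow> int \<Rightarrow> int \<Rightarrow> int \<Rightarrow> int \<Rightarrow> int" where
  "eberlein l u w q p =
     (\<Sum>j\<le>l. (-1) ^ j * int (l choose j) * binom u (q - int j) * binom w (p - int j))"

lemma eberlein_0: "eberlein 0 u w q p = binom u q * binom w p"
  by (simp add: eberlein_def)

lemma eberlein_Suc:
  "eberlein (Suc l) u w q p = eberlein l u w q p - eberlein l u w (q - 1) (p - 1)"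
proof -
  define g where "g j = (-1) ^ j * (binom u (q - int j) * binom w (p - int j))" for j
  have "eberlein (Suc l) u w q p = (\<Sum>j\<le>Suc l. int (Suc l choose j) * g j)"
    by (simp add: eberlein_def g_def mult_ac)
  also have "\<dots> = g 0 + (\<Sum>j\<le>l. int (l choose j) * g (Suc j)) + (\<Sum>j\<le>l. int (l choose Suc j) * g (Suc j))"
    by (subst sum.atMost_Suc_shift) (simp add: algebra_simps sum.distrib)
  also have "(\<Sum>j\<le>l. int (l choose Suc j) * g (Suc j)) + g 0 = (\<Sum>j\<le>l. int (l choose j) * g j)"
    using sum.atMost_Suc_shift[of "\<lambda>j. int (l choose j) * g j" l] by (simp add: binomial_eq_0)
  then have "g 0 + (\<Sum>j\<le>l. int (l choose j) * g (Suc j)) + (\<Sum>j\<le>l. int (l choose Suc j) * g (Suc j))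
      = (\<Sum>j\<le>l. int (l choose j) * g j) + (\<Sum>j\<le>l. int (l choose j) * g (Suc j))"
    by linarith
  also have "(\<Sum>j\<le>l. int (l choose j) * g j) = eberlein l u w q p"
    by (simp add: eberlein_def g_def mult_ac)
  also have "(\<Sum>j\<le>l. int (l choose j) * g (Suc j)) = - eberlein l u w (q - 1) (p - 1)"
    by (simp add: eberlein_def g_def mult_ac sum_negf algebra_simps)
  finally show ?thesis by simp
qed

lemma sum_Pow_insert:
  assumes "finite A" "a \<notin> A"
  shows "(\<Sum>T\<in>Pow (insert a A). h T) = (\<Sum>T\<in>Pow A. h T + h (insert a T))"
proof -
  have "inj_on (insert a) (Pow A)" using assms(2) by (auto simp: inj_on_def)
  moreover have "Pow A \<inter> insert a ` Pow A = {}" using assms(2) by auto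
  ultimately show ?thesis
    using assms(1) by (simp add: Pow_insert sum.union_disjoint sum.reindex sum.distrib)
qed

lemma card_two_sided:
  assumes "finite P" "S \<subseteq> P"
  shows "int (card {T. T \<subseteq> P \<and> int (card (S - T)) = q \<and> int (card (T - S)) = p})
           = binom (int (card S)) q * binom (int (card (P - S))) p"
proof (cases "q < 0 \<or> p < 0")
  case True
  then have "{T. T \<subseteq> P \<and> int (card (S - T)) = q \<and> int (card (T - S)) = p} = {}" by auto
  then show ?thesis using True by (auto simp: binom_def simp del: Collect_empty_eq)
next
  case False
  have fin: "finite S" "finite (P - S)" using assms finite_subset by auto
  let ?A = "{A. A \<subseteq> S \<and> card A = nat q}" and ?B = "{B. B \<subseteq> P - S \<and> card B = nat p}"
  have "bij_betw (\<lambda>(A, B). (S - A) \<union> B) (?A \<times> ?B)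
      {T. T \<subseteq> P \<and> int (card (S - T)) = q \<and> int (card (T - S)) = p}"
  proof (rule bij_betw_byWitness[where f' = "\<lambda>T. (S - T, T - S)"])
    show "\<forall>z\<in>?A \<times> ?B. (\<lambda>T. (S - T, T - S)) ((\<lambda>(A, B). (S - A) \<union> B) z) = z" by auto
    show "\<forall>T\<in>{T. T \<subseteq> P \<and> int (card (S - T)) = q \<and> int (card (T - S)) = p}.
        (\<lambda>(A, B). (S - A) \<union> B) (S - T, T - S) = T" by auto
    have "S - (S - A \<union> B) = A" "S - A \<union> B - S = B" if "A \<subseteq> S" "B \<subseteq> P - S" for A B
      using that by auto
    then show "(\<lambda>(A, B). (S - A) \<union> B) ` (?A \<times> ?B)
        \<subseteq> {T. T \<subseteq> P \<and> int (card (S - T)) = q \<and> int (card (T - S)) = p}"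
      using assms False by auto
    show "(\<lambda>T. (S - T, T - S)) ` {T. T \<subseteq> P \<and> int (card (S - T)) = q \<and> int (card (T - S)) = p}
        \<subseteq> ?A \<times> ?B" by auto
  qed
  then have "card {T. T \<subseteq> P \<and> int (card (S - T)) = q \<and> int (card (T - S)) = p}
      = (card S choose nat q) * (card (P - S) choose nat p)"
    using fin by (simp add: n_subsets card_cartesian_product flip: bij_betw_same_card)
  then show ?thesis using False by (auto simp: binom_def binomial_eq_0)
qed

lemma pair_fun_insert:
  "a \<notin> fst ` set ps \<union> snd ` set ps \<Longrightarrow> pair_fun ps (insert a T) = pair_fun ps T"
  by (induction ps) auto

text \<open>
  Summing out the first pair: the sets containing none or both of its elements do not contribute,
  and the swap of the two elements changes the sign and shifts both cardinalities by one.
\<close>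

lemma sum_pair_fun:
  assumes "finite P" "S \<subseteq> P"
    and "distinct (map fst ps @ map snd ps)" "fst ` set ps \<union> snd ` set ps \<subseteq> P"
  shows "(\<Sum>T | T \<subseteq> P \<and> int (card (S - T)) = q \<and> int (card (T - S)) = p. pair_fun ps T)
     = of_int (eberlein (length ps) (int (card S) - int (length ps))
                 (int (card (P - S)) - int (length ps)) q p) * (pair_fun ps S :: 'k::comm_ring_1)"
  using assms
proof (induction ps arbitrary: P S q p)
  case Nil
  then show ?case
    by (simp add: eberlein_0 flip: card_two_sided[of P S q p])
next
  case (Cons ab ps)
  obtain a b where ab: "ab = (a, b)" by fastforce
  define P' S' where "P' = P - {a, b}" and "S' = S - {a, b}"
  have a: "a \<noteq> b" "a \<in> P" "b \<in> P" "a \<notin> fst ` set ps \<union> snd ` set ps" "b \<notin> fst ` set ps \<union> snd ` set ps"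
    using Cons.prems(3,4) by (auto simp: ab)
  have P: "P = insert a (insert b P')" "a \<notin> insert b P'" "b \<notin> P'" "finite P'"
    using a Cons.prems(1) by (auto simp: P'_def)
  have fS: "finite S" using Cons.prems(1,2) finite_subset by auto
  have S': "S' \<subseteq> P'" "finite S'" using Cons.prems fS by (auto simp: P'_def S'_def)
  define F where "F q p = (\<Sum>T | T \<subseteq> P' \<and> int (card (S' - T)) = q \<and> int (card (T - S')) = p. pair_fun ps T :: 'k)" for q p
  define G where "G q p T = (if int (card (S' - T)) = q \<and> int (card (T - S')) = p then pair_fun ps T else (0::'k))" for q p T
  have FG: "F q p = (\<Sum>T\<in>Pow P'. G q p T)" for q p
    unfolding F_def G_def using P(4)
    by (subst sum.inter_filter[symmetric]) (auto intro!: sum.cong)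
  have F: "F q p = of_int (eberlein (length ps) (int (card S') - int (length ps))
                 (int (card (P' - S')) - int (length ps)) q p) * pair_fun ps S'" for q p
    unfolding F_def using Cons.prems a by (intro Cons.IH P S') (auto simp: ab P'_def)
  define H where "H T = (if int (card (S - T)) = q \<and> int (card (T - S)) = p then pair_fun (ab # ps) T else (0::'k))" for T
  have "(\<Sum>T | T \<subseteq> P \<and> int (card (S - T)) = q \<and> int (card (T - S)) = p. pair_fun (ab # ps) T :: 'k)
      = (\<Sum>T\<in>Pow P. H T)"
    unfolding H_def using Cons.prems(1)
    by (subst sum.inter_filter[symmetric]) (auto intro!: sum.cong)
  also have "\<dots> = (\<Sum>T\<in>Pow P'. H T + H (insert b T) + (H (insert a T) + H (insert a (insert b T))))"
    unfolding P(1) using P by (simp add: sum_Pow_insert add_ac)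
  also have "\<dots> = (\<Sum>T\<in>Pow P'. H (insert a T) + H (insert b T))"
  proof (rule sum.cong)
    fix T assume "T \<in> Pow P'"
    then have "H T = 0" "H (insert a (insert b T)) = 0" using P by (auto simp: H_def ab)
    then show "H T + H (insert b T) + (H (insert a T) + H (insert a (insert b T)))
        = H (insert a T) + H (insert b T)" by simp
  qed simp
  also have "\<dots> = of_int (eberlein (length (ab # ps)) (int (card S) - int (length (ab # ps)))
                 (int (card (P - S)) - int (length (ab # ps))) q p) * pair_fun (ab # ps) S"
  proof -
    have T: "a \<notin> T" "b \<notin> T" "finite T" if "T \<in> Pow P'" for T
      using that P(2-4) finite_subset[of T P'] by auto
    have Ha: "H (insert a T) = (if int (card (S - insert a T)) = q \<and> int (card (insert a T - S)) = p
        then pair_fun ps T else 0)"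
      and Hb: "H (insert b T) = - (if int (card (S - insert b T)) = q \<and> int (card (insert b T - S)) = p
        then pair_fun ps T else 0)" if "T \<in> Pow P'" for T
      using T[OF that] a by (simp_all add: H_def ab pair_fun_insert)
    consider "a \<in> S" "b \<notin> S" | "a \<notin> S" "b \<in> S" | "a \<in> S \<longleftrightarrow> b \<in> S" by blast
    then show ?thesis
    proof cases
      case 1
      have eq: "S - insert a T = S' - T" "insert a T - S = T - S'"
          "S - insert b T = insert a (S' - T)" "insert b T - S = insert b (T - S')"
          "a \<notin> S' - T" "b \<notin> T - S'" if "T \<in> Pow P'" for T
        using 1 T[OF that] by (auto simp: S'_def)
      have "H (insert a T) = G q p T" "H (insert b T) = - G (q - 1) (p - 1) T" if "T \<in> Pow P'" for T
        unfolding Ha[OF that] Hb[OF that] eq[OF that] G_def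
        using T[OF that] eq(5,6)[OF that] S' by auto
      then have "(\<Sum>T\<in>Pow P'. H (insert a T) + H (insert b T)) = F q p - F (q - 1) (p - 1)"
        by (simp add: FG sum_subtractf)
      moreover have "S = insert a S'" "a \<notin> S'" using 1 by (auto simp: S'_def)
      moreover have "P - S = insert b (P' - S')" "b \<notin> P' - S'" using 1 a by (auto simp: S'_def P'_def)
      ultimately show ?thesis
        using 1 S' P(4) by (simp add: F eberlein_Suc ab algebra_simps pair_fun_insert[OF a(4)] pair_fun_insert[OF a(5)])
    next
      case 2
      have eq: "S - insert b T = S' - T" "insert b T - S = T - S'"
          "S - insert a T = insert b (S' - T)" "insert a T - S = insert a (T - S')"
          "b \<notin> S' - T" "a \<notin> T - S'" if "T \<in> Pow P'" for T
        using 2 T[OF that] by (auto simp: S'_def)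
      have "H (insert b T) = - G q p T" "H (insert a T) = G (q - 1) (p - 1) T" if "T \<in> Pow P'" for T
        unfolding Ha[OF that] Hb[OF that] eq[OF that] G_def
        using T[OF that] eq(5,6)[OF that] S' by auto
      then have "(\<Sum>T\<in>Pow P'. H (insert a T) + H (insert b T)) = F (q - 1) (p - 1) - F q p"
        by (simp add: FG sum_subtractf)
      moreover have "S = insert b S'" "b \<notin> S'" using 2 by (auto simp: S'_def)
      moreover have "P - S = insert a (P' - S')" "a \<notin> P' - S'" using 2 a by (auto simp: S'_def P'_def)
      ultimately show ?thesis
        using 2 S' P(4) by (simp add: F eberlein_Suc ab algebra_simps pair_fun_insert[OF a(4)] pair_fun_insert[OF a(5)])
    next
      case 3
      have "card (S - insert a T) = card (S - insert b T)"
        "card (insert a T - S) = card (insert b T - S)" if "T \<in> Pow P'" for T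
      proof -
        have "S - insert a T = (if a \<in> S then insert b (S' - T) else S' - T)"
             "S - insert b T = (if a \<in> S then insert a (S' - T) else S' - T)"
             "a \<notin> S' - T" "b \<notin> S' - T"
          using 3 a(1) T[OF that] by (auto simp: S'_def)
        then show "card (S - insert a T) = card (S - insert b T)"
          using S'(2) by simp
        show "card (insert a T - S) = card (insert b T - S)"
          using 3 T[OF that] by (cases "a \<in> S") (simp_all add: insert_Diff_if)
      qed
      then have "H (insert a T) + H (insert b T) = 0" if "T \<in> Pow P'" for T
        unfolding Ha[OF that] Hb[OF that] using that by simp
      then show ?thesis using 3 by (simp add: ab)
    qed
  qed
  finally show ?case .
qed

lemma eberlein_neg: "q < 0 \<Longrightarrow> eberlein l u w q p = 0"
  by (simp add: eberlein_def binom_def)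

lemma eberlein_zero_zero:
  "0 \<le> u \<Longrightarrow> 0 \<le> w \<Longrightarrow> eberlein l u w 0 0 = 1"
  by (induction l) (simp_all add: eberlein_0 eberlein_Suc eberlein_neg binom_def)

lemma eberlein_one_one:
  "0 \<le> u \<Longrightarrow> 0 \<le> w \<Longrightarrow> eberlein l u w 1 1 = u * w - int l"
  by (induction l) (auto simp: eberlein_0 eberlein_Suc eberlein_zero_zero binom_def)

lemma eberlein_one_one_inj: "inj_on (\<lambda>l. eberlein l (int s - int l) (int r - int l) 1 1) {..min s r}"
proof (rule inj_onI)
  fix l l' assume "l \<in> {..min s r}" "l' \<in> {..min s r}"
    and eq: "eberlein l (int s - int l) (int r - int l) 1 1 = eberlein l' (int s - int l') (int r - int l') 1 1"
  then have le: "l \<le> s" "l \<le> r" "l' \<le> s" "l' \<le> r" by auto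
  with eq have "(int l - int l') * (int s + int r + 1 - int l - int l') = 0"
    by (simp add: eberlein_one_one algebra_simps)
  moreover have "int s + int r + 1 - int l - int l' \<noteq> 0" using le by linarith
  ultimately show "l = l'" by simp
qed

section \<open>The Johnson scheme\<close>

locale johnson =
  fixes P :: "'a set" and s r :: nat
  assumes finite_P: "finite P" and card_P: "card P = s + r"
begin

abbreviation m :: nat where "m \<equiv> min s r"

definition layer :: "'a set set" where
  "layer = {S. S \<subseteq> P \<and> card S = s}"

definition conv :: "(nat \<Rightarrow> 'k::comm_ring_1) \<Rightarrow> ('a set \<Rightarrow> 'k) \<Rightarrow> 'a set \<Rightarrow> 'k" where
  "conv \<phi> g S = (\<Sum>T\<in>layer. \<phi> (card (T - S)) * g T)"

definition delta :: "nat \<Rightarrow> nat \<Rightarrow> 'k::comm_ring_1" where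
  "delta t u = of_bool (u = t)"

text \<open>
  The action of \<open>conv (delta 1)\<close> on kernels. The junk values \<open>\<phi> (0 - 1)\<close> and \<open>\<phi> (m + 1)\<close> carry
  the coefficient 0.
\<close>

definition lap :: "(nat \<Rightarrow> 'k::comm_ring_1) \<Rightarrow> nat \<Rightarrow> 'k" where
  "lap \<phi> u = of_nat ((s - u) * (r - u)) * \<phi> (u + 1)
     + of_nat (u * (s - u) + u * (r - u)) * \<phi> u + of_nat (u * u) * \<phi> (u - 1)"

lemma finite_layer: "finite layer"
  unfolding layer_def using finite_P by simp

lemma layer_D: "S \<in> layer \<Longrightarrow> S \<subseteq> P" "S \<in> layer \<Longrightarrow> card S = s" "S \<in> layer \<Longrightarrow> finite S"
  "S \<in> layer \<Longrightarrow> card (P - S) = r"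
  using finite_P card_P by (auto simp: layer_def card_Diff_subset finite_subset)

lemma card_diff_commute:
  assumes "S \<in> layer" "T \<in> layer"
  shows "card (S - T) = card (T - S)"
proof -
  have "card S + card (T - S) = card T + card (S - T)"
    using assms[THEN layer_D(3)] by (metis card_Un_disjoint Diff_disjoint Un_Diff_cancel Un_commute finite_Diff)
  then show ?thesis using assms by (simp add: layer_D)
qed

lemma card_diff_le:
  assumes "S \<in> layer" "T \<in> layer"
  shows "card (T - S) \<le> m"
proof -
  have "card (T - S) \<le> card T" "card (T - S) \<le> card (P - S)"
    using layer_D[OF assms(2)] finite_P by (auto intro!: card_mono)
  then show ?thesis using assms by (simp add: layer_D)
qed

lemma neighbours:
  assumes "S \<in> layer"
  shows "bij_betw (\<lambda>(a, b). insert b (S - {a})) (S \<times> (P - S)) {T \<in> layer. card (T - S) = 1}"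
  unfolding bij_betw_def
proof
  note S = layer_D[OF assms]
  show "inj_on (\<lambda>(a, b). insert b (S - {a})) (S \<times> (P - S))"
  proof (rule inj_onI, clarify)
    fix a b a' b' assume *: "a \<in> S" "b \<notin> S" "a' \<in> S" "b' \<notin> S"
      and eq: "insert b (S - {a}) = insert b' (S - {a'})"
    have "insert b (S - {a}) - S = {b}" "S - insert b (S - {a}) = {a}"
      "insert b' (S - {a'}) - S = {b'}" "S - insert b' (S - {a'}) = {a'}" using * by auto
    then show "a = a' \<and> b = b'" unfolding eq by simp
  qed
  show "(\<lambda>(a, b). insert b (S - {a})) ` (S \<times> (P - S)) = {T \<in> layer. card (T - S) = 1}"
  proof (intro equalityI subsetI)
    fix T assume "T \<in> (\<lambda>(a, b). insert b (S - {a})) ` (S \<times> (P - S))"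
    then obtain a b where ab: "a \<in> S" "b \<in> P" "b \<notin> S" "T = insert b (S - {a})" by auto
    then have "T - S = {b}" by auto
    moreover have "card T = s"
      using ab S card_Suc_Diff1[of S a] by simp
    ultimately show "T \<in> {T \<in> layer. card (T - S) = 1}" using ab S by (auto simp: layer_def)
  next
    fix T assume T: "T \<in> {T \<in> layer. card (T - S) = 1}"
    then obtain b where b: "T - S = {b}" by (auto simp: card_1_singleton_iff)
    from T card_diff_commute[OF assms, of T] obtain a where a: "S - T = {a}"
      by (auto simp: card_1_singleton_iff)
    have "T = insert b (S - {a})" using a b by blast
    moreover have "a \<in> S" "b \<in> P - S" using a b T layer_D by auto
    ultimately show "T \<in> (\<lambda>(a, b). insert b (S - {a})) ` (S \<times> (P - S))" by force
  qed
qed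

lemma sum_neighbours:
  assumes "S \<in> layer" "U \<in> layer"
  shows "(\<Sum>T\<in>layer. delta 1 (card (T - S)) * \<phi> (card (U - T))) = lap \<phi> (card (U - S))"
proof -
  note S = layer_D[OF assms(1)] and U = layer_D[OF assms(2)]
  define u where "u = card (U - S)"
  define h where "h a b = \<phi> (card (U - insert b (S - {a})))" for a b
  have inner: "(\<Sum>b\<in>P - S. h a b) = (\<Sum>b\<in>U - S. h a b) + (\<Sum>b\<in>P - S - U. h a b)" for a
    using S U finite_P by (subst sum.union_disjoint[symmetric]) (auto intro!: sum.cong)
  have "(\<Sum>T\<in>layer. delta 1 (card (T - S)) * \<phi> (card (U - T)))
      = (\<Sum>T | T \<in> layer \<and> card (T - S) = 1. \<phi> (card (U - T)))"
    unfolding sum.inter_filter[OF finite_layer] by (intro sum.cong) (auto simp: delta_def)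
  also have "\<dots> = (\<Sum>(a, b)\<in>S \<times> (P - S). h a b)"
    by (subst sum.reindex_bij_betw[OF neighbours[OF assms(1)], symmetric])
      (auto simp: h_def intro!: sum.cong)
  also have "\<dots> = (\<Sum>a\<in>S. \<Sum>b\<in>P - S. h a b)"
    by (simp add: sum.cartesian_product)
  also have "\<dots> = (\<Sum>a\<in>S \<inter> U. \<Sum>b\<in>P - S. h a b) + (\<Sum>a\<in>S - U. \<Sum>b\<in>P - S. h a b)"
    using S by (subst sum.union_disjoint[symmetric]) (auto intro!: sum.cong)
  also have "\<dots> = (\<Sum>a\<in>S \<inter> U. (\<Sum>b\<in>U - S. h a b) + (\<Sum>b\<in>P - S - U. h a b))
      + (\<Sum>a\<in>S - U. (\<Sum>b\<in>U - S. h a b) + (\<Sum>b\<in>P - S - U. h a b))"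
    unfolding inner ..
  also have "(\<Sum>a\<in>S \<inter> U. (\<Sum>b\<in>U - S. h a b) + (\<Sum>b\<in>P - S - U. h a b))
      = (\<Sum>a\<in>S \<inter> U. (\<Sum>b\<in>U - S. \<phi> u) + (\<Sum>b\<in>P - S - U. \<phi> (u + 1)))"
  proof (intro sum.cong arg_cong2[where f = "(+)"] refl)
    fix a b assume a: "a \<in> S \<inter> U"
    { assume b: "b \<in> U - S"
      have "U - insert b (S - {a}) = insert a (U - S - {b})" using a b by auto
      then show "h a b = \<phi> u"
        using a b U card_Suc_Diff1[of "U - S" b] by (simp add: h_def u_def) }
    { assume b: "b \<in> P - S - U"
      have "U - insert b (S - {a}) = insert a (U - S)" using a b by auto
      then show "h a b = \<phi> (u + 1)" using a b U by (simp add: h_def u_def) }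
  qed
  also have "(\<Sum>a\<in>S - U. (\<Sum>b\<in>U - S. h a b) + (\<Sum>b\<in>P - S - U. h a b))
      = (\<Sum>a\<in>S - U. (\<Sum>b\<in>U - S. \<phi> (u - 1)) + (\<Sum>b\<in>P - S - U. \<phi> u))"
  proof (intro sum.cong arg_cong2[where f = "(+)"] refl)
    fix a b assume a: "a \<in> S - U"
    { assume b: "b \<in> U - S"
      have "U - insert b (S - {a}) = U - S - {b}" using a b by auto
      then show "h a b = \<phi> (u - 1)" using a b U by (simp add: h_def u_def) }
    { assume b: "b \<in> P - S - U"
      have "U - insert b (S - {a}) = U - S" using a b by auto
      then show "h a b = \<phi> u" by (simp add: h_def u_def) }
  qed
  finally have *: "(\<Sum>T\<in>layer. delta 1 (card (T - S)) * \<phi> (card (U - T)))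
      = (\<Sum>a\<in>S \<inter> U. (\<Sum>b\<in>U - S. \<phi> u) + (\<Sum>b\<in>P - S - U. \<phi> (u + 1)))
        + (\<Sum>a\<in>S - U. (\<Sum>b\<in>U - S. \<phi> (u - 1)) + (\<Sum>b\<in>P - S - U. \<phi> u))" .
  have cSU: "card (S - U) = u" using card_diff_commute[OF assms] by (simp add: u_def)
  have "card (S \<inter> U) + card (S - U) = s"
    using S by (metis card_Int_Diff)
  then have c1: "card (S \<inter> U) = s - u" using cSU by simp
  have "P - S - U = (P - S) - (U - S)" by auto
  then have c2: "card (P - S - U) = r - u"
    using S U finite_P by (subst \<open>P - S - U = _\<close>, subst card_Diff_subset) (auto simp: u_def)
  show ?thesis
    unfolding * lap_def u_def[symmetric]
    by (simp add: c1 c2 cSU u_def[symmetric] distrib_left distrib_right mult_ac add_ac)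
qed

lemma conv_delta_1:
  assumes "S \<in> layer"
  shows "conv (delta 1) (conv \<phi> g) S = conv (lap \<phi>) g S"
proof -
  have "conv (delta 1) (conv \<phi> g) S
      = (\<Sum>U\<in>layer. \<Sum>T\<in>layer. delta 1 (card (T - S)) * \<phi> (card (U - T)) * g U)"
    unfolding conv_def by (subst sum.swap) (simp add: sum_distrib_left mult_ac)
  also have "\<dots> = conv (lap \<phi>) g S"
    unfolding conv_def
    by (intro sum.cong refl) (simp add: sum_neighbours[OF assms, symmetric] sum_distrib_right)
  finally show ?thesis .
qed

lemma conv_delta_1_commute:
  assumes "S \<in> layer"
  shows "conv \<phi> (conv (delta 1) g) S = conv (delta 1) (conv \<phi> g) S"
proof -
  have "conv \<phi> (conv (delta 1) g) S
      = (\<Sum>U\<in>layer. \<Sum>T\<in>layer. delta 1 (card (U - T)) * \<phi> (card (T - S)) * g U)"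
    unfolding conv_def by (subst sum.swap) (simp add: sum_distrib_left mult_ac)
  also have "\<dots> = (\<Sum>U\<in>layer. (\<Sum>T\<in>layer. delta 1 (card (T - U)) * \<phi> (card (S - T))) * g U)"
    unfolding sum_distrib_right using assms by (intro sum.cong refl) (simp add: card_diff_commute)
  also have "\<dots> = conv (lap \<phi>) g S"
    unfolding conv_def
    by (intro sum.cong refl) (simp only: sum_neighbours[OF _ assms] card_diff_commute[OF assms])
  finally show ?thesis by (simp only: conv_delta_1[OF assms])
qed

lemma conv_delta_0: "S \<in> layer \<Longrightarrow> conv (delta 0) g S = g S"
proof -
  assume S: "S \<in> layer"
  have "card (T - S) = 0 \<longleftrightarrow> T = S" if "T \<in> layer" for T
    using that S layer_D card_subset_eq[of S T] by (metis Diff_eq_empty_iff card_0_eq finite_Diff subset_refl)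
  then have "conv (delta 0) g S = (\<Sum>T\<in>layer. if T = S then g T else 0)"
    unfolding conv_def by (intro sum.cong) (auto simp: delta_def)
  then show ?thesis using S finite_layer by simp
qed

lemma conv_expand:
  assumes "S \<in> layer"
  shows "conv \<phi> g S = (\<Sum>t\<le>m. \<phi> t * conv (delta t) g S)"
proof -
  have "(\<Sum>t\<le>m. \<phi> t * conv (delta t) g S)
      = (\<Sum>T\<in>layer. \<Sum>t\<le>m. if card (T - S) = t then \<phi> t * g T else 0)"
    unfolding conv_def sum_distrib_left
    by (subst sum.swap) (intro sum.cong refl, simp add: delta_def)
  also have "\<dots> = conv \<phi> g S"
    unfolding conv_def by (intro sum.cong refl) (use card_diff_le[OF assms] in auto)
  finally show ?thesis by simp
qed

lemma conv_cong: "(\<And>T. T \<in> layer \<Longrightarrow> g T = h T) \<Longrightarrow> conv \<phi> g S = conv \<phi> h S"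
  unfolding conv_def by (intro sum.cong) auto

definition eigenseq :: "'k::comm_ring_1 \<Rightarrow> (nat \<Rightarrow> 'k) \<Rightarrow> bool" where
  "eigenseq \<theta> h \<longleftrightarrow> (\<forall>\<phi>. (\<Sum>u\<le>m. lap \<phi> u * h u) = \<theta> * (\<Sum>u\<le>m. \<phi> u * h u))"

text \<open>Testing \<open>eigenseq\<close> on the functions \<open>delta t\<close> gives a three-term recurrence.\<close>

lemma recurrence_polys:
  obtains p :: "nat \<Rightarrow> 'k::field_char_0 poly" where
    "\<And>t. t \<le> m \<Longrightarrow> degree (p t) = t \<and> p t \<noteq> 0"
    "\<And>t h \<theta>. t \<le> m
       \<Longrightarrow> eigenseq \<theta> h
       \<Longrightarrow> h t = h 0 * poly (p t) \<theta>"
proof -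
  have "\<exists>p :: 'k poly. degree p = t \<and> p \<noteq> 0 \<and>
      (\<forall>h \<theta>. eigenseq \<theta> h \<longrightarrow> h t = h 0 * poly p \<theta>)"
    if "t \<le> m" for t
    using that
  proof (induction t rule: less_induct)
    case (less t)
    show ?case
    proof (cases t)
      case 0
      then show ?thesis by (intro exI[of _ 1]) simp
    next
      case (Suc t')
      obtain p :: "'k poly" where p: "degree p = t'" "p \<noteq> 0"
        "\<And>h \<theta>. eigenseq \<theta> h \<Longrightarrow> h t' = h 0 * poly p \<theta>"
      proof -
        have "t' < t" "t' \<le> m" using Suc less.prems by auto
        from less.IH[OF this] show ?thesis using that by blast
      qed
      obtain q :: "'k poly" where q: "degree q \<le> t'"
        "\<And>h \<theta>. eigenseq \<theta> h \<Longrightarrow> 0 < t' \<Longrightarrow> h (t' - 1) = h 0 * poly q \<theta>"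
      proof (cases t')
        case 0
        show ?thesis by (rule that[of 0]) (simp_all add: 0)
      next
        case (Suc t'')
        then have "t'' < t" "t'' \<le> m" using \<open>t = Suc t'\<close> less.prems by auto
        from less.IH[OF this] obtain q :: "'k poly" where "degree q = t''"
         "\<And>h \<theta>. eigenseq \<theta> h \<Longrightarrow> h t'' = h 0 * poly q \<theta>"
          by blast
        then show ?thesis using Suc by (intro that[of q]) auto
      qed
      define a b c :: 'k where "a = of_nat ((t' + 1) * (t' + 1))"
        and "b = of_nat (t' * (s - t') + t' * (r - t'))"
        and "c = (if t' = 0 then 0 else of_nat ((s - (t' - 1)) * (r - (t' - 1))))"
      have a: "a \<noteq> 0" unfolding a_def of_nat_eq_0_iff by simp
      define pn where "pn = smult (1 / a) ([:- b, 1:] * p - smult c q)"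
      have "degree ([:- b, 1:] * p) = Suc t'"
        using p(1,2) by (subst degree_mult_eq) auto
      then have "degree ([:- b, 1:] * p - smult c q) = Suc t'"
        using q(1) degree_smult_le[of c q]
        by (subst diff_conv_add_uminus, subst degree_add_eq_left) auto
      then have "degree pn = t" "pn \<noteq> 0" using a Suc by (auto simp: pn_def)
      moreover have "h t = h 0 * poly pn \<theta>"
        if H: "eigenseq \<theta> h" for h :: "nat \<Rightarrow> 'k" and \<theta>
      proof -
        have t': "t' + 1 \<le> m" using less.prems Suc by simp
        have "(\<Sum>u\<le>m. lap (delta t') u * h u)
            = (\<Sum>u\<le>m. (if u = t' + 1 then a * h u else 0) + (if u = t' then b * h u else 0)
                 + (if u = t' - 1 then if t' \<noteq> 0 then c * h (t' - 1) else 0 else 0))"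
        proof (intro sum.cong refl)
          fix u
          consider "u = t' + 1" | "u = t'" | "u + 1 = t'" | "u > t' + 1" | "u + 1 < t'" by linarith
          then show "lap (delta t') u * h u = (if u = t' + 1 then a * h u else 0)
              + (if u = t' then b * h u else 0)
              + (if u = t' - 1 then if t' \<noteq> 0 then c * h (t' - 1) else 0 else 0)"
            by cases (auto simp: lap_def delta_def a_def b_def c_def)
        qed
        also have "\<dots> = a * h t + b * h t' + (if t' \<noteq> 0 then c * h (t' - 1) else 0)"
          using t' Suc by (auto simp: sum.distrib)
        also have "(if t' \<noteq> 0 then c * h (t' - 1) else 0) = c * (h 0 * poly q \<theta>)"
          using q(2)[OF H] by (simp add: c_def)
        also have "(\<Sum>u\<le>m. lap (delta t') u * h u) = \<theta> * h t'"
          using t' by (subst H[unfolded eigenseq_def, rule_format]) (simp add: delta_def if_distrib[of "\<lambda>x. x * _"] cong: if_cong)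
        finally have "a * h t = (\<theta> - b) * h t' - c * (h 0 * poly q \<theta>)"
          by (simp add: algebra_simps)
        also have "h t' = h 0 * poly p \<theta>" by (rule p(3)[OF H])
        finally show ?thesis using a by (simp add: pn_def field_simps)
      qed
      ultimately show ?thesis by blast
    qed
  qed
  then obtain p :: "nat \<Rightarrow> 'k poly" where "\<And>t. t \<le> m \<Longrightarrow> degree (p t) = t \<and> p t \<noteq> 0 \<and>
      (\<forall>h \<theta>. eigenseq \<theta> h \<longrightarrow> h t = h 0 * poly (p t) \<theta>)"
    by metis
  then show thesis using that by blast
qed

definition ev :: "nat \<Rightarrow> nat \<Rightarrow> 'k::comm_ring_1" where
  "ev l t = of_int (eberlein l (int s - int l) (int r - int l) (int t) (int t))"

definition hat :: "(nat \<Rightarrow> 'k::comm_ring_1) \<Rightarrow> nat \<Rightarrow> 'k" where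
  "hat \<phi> l = (\<Sum>t\<le>m. \<phi> t * ev l t)"

definition theta :: "nat \<Rightarrow> 'k::comm_ring_1" where
  "theta l = hat (delta 1) l"

lemma ev_0: "l \<le> m \<Longrightarrow> ev l 0 = 1"
  by (simp add: ev_def eberlein_zero_zero)

lemma hat_delta: "t \<le> m \<Longrightarrow> hat (delta t) l = ev l t"
  by (simp add: hat_def delta_def if_distrib[of "\<lambda>x. x * _"] of_bool_def cong: if_cong)

lemma theta_inj: "inj_on (theta :: nat \<Rightarrow> 'k::field_char_0) {..m}"
proof (cases "m = 0")
  case True
  then show ?thesis by (auto simp: inj_on_def)
next
  case False
  then have "theta l = (of_int (eberlein l (int s - int l) (int r - int l) 1 1) :: 'k)" for l
    by (simp add: theta_def hat_delta ev_def del: One_nat_def)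
  then show ?thesis using eberlein_one_one_inj by (simp add: inj_on_def)
qed

lemma eigenfunction:
  assumes "l \<le> m"
  obtains f :: "'a set \<Rightarrow> 'k::field_char_0" where "\<exists>S\<in>layer. f S \<noteq> 0"
    "\<And>\<phi> T. T \<in> layer \<Longrightarrow> conv \<phi> f T = hat \<phi> l * f T"
proof -
  obtain S where S: "S \<subseteq> P" "card S = s" "finite S"
    using obtain_subset_with_card_n[of s P] card_P by auto
  have cPS: "card (P - S) = r" using S finite_P card_P by (simp add: card_Diff_subset)
  obtain A where A: "A \<subseteq> S" "card A = l" "finite A"
    using obtain_subset_with_card_n[of l S] S assms by auto
  obtain B where B: "B \<subseteq> P - S" "card B = l" "finite B"
    using obtain_subset_with_card_n[of l "P - S"] cPS assms by auto
  obtain as where as: "set as = A" "distinct as" using finite_distinct_list[OF A(3)] by auto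
  obtain bs where bs: "set bs = B" "distinct bs" using finite_distinct_list[OF B(3)] by auto
  have len: "length as = l" "length bs = l" using as bs A B distinct_card by fastforce+
  define ps where "ps = zip as bs"
  have ps: "map fst ps = as" "map snd ps = bs" "length ps = l" using len by (simp_all add: ps_def)
  then have ps': "fst ` set ps = A" "snd ` set ps = B"
    using as bs by (metis list.set_map)+
  define f :: "'a set \<Rightarrow> 'k" where "f = pair_fun ps"
  have one: "pair_fun qs S = (1 :: 'k)" if "fst ` set qs \<subseteq> S" "snd ` set qs \<inter> S = {}" for qs
    using that by (induction qs) auto
  have "f S = 1" unfolding f_def by (rule one) (use ps' A(1) B(1) in auto)
  then have f_nz: "f S \<noteq> 0" by simp
  have S_layer: "S \<in> layer" using S by (simp add: layer_def)
  have "conv \<phi> f T = hat \<phi> l * f T" if T: "T \<in> layer" for \<phi> T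
  proof -
    have "conv (delta t) f T = ev l t * f T" for t
    proof -
      have "conv (delta t) f T = (\<Sum>U | U \<in> layer \<and> card (U - T) = t. f U)"
        unfolding conv_def sum.inter_filter[OF finite_layer]
        by (intro sum.cong) (auto simp: delta_def)
      also have "{U. U \<in> layer \<and> card (U - T) = t}
          = {U. U \<subseteq> P \<and> int (card (T - U)) = int t \<and> int (card (U - T)) = int t}"
      proof -
        have "card U = s" if "U \<subseteq> P" "card (T - U) = card (U - T)" for U
          using that layer_D[OF T] finite_subset[OF _ finite_P, of U]
          by (metis card_Int_Diff Int_commute)
        then have "U \<in> layer \<and> card (U - T) = t \<longleftrightarrow>
            U \<subseteq> P \<and> int (card (T - U)) = int t \<and> int (card (U - T)) = int t" for U
          unfolding layer_def using card_diff_commute[OF T, of U] by (auto simp: layer_def)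
        then show ?thesis by simp
      qed
      also have "(\<Sum>U\<in>\<dots>. f U) = ev l t * f T"
        unfolding f_def
      proof (subst sum_pair_fun)
        have "A \<inter> B = {}" using A(1) B(1) by auto
        then show "distinct (map fst ps @ map snd ps)" unfolding ps(1,2) using as bs by simp
        show "fst ` set ps \<union> snd ` set ps \<subseteq> P" unfolding ps' using A(1) B(1) S(1) by auto
      qed (use layer_D[OF T] finite_P ps(3) in \<open>simp_all add: ev_def\<close>)
      finally show ?thesis .
    qed
    then show ?thesis
      using T by (subst conv_expand) (simp_all add: hat_def sum_distrib_right mult.assoc)
  qed
  moreover have "\<exists>S\<in>layer. f S \<noteq> 0" using S_layer f_nz by blast
  ultimately show thesis by (intro that[of f])
qed

lemma hat_lap:
  assumes "l \<le> m"
  shows "hat (lap \<phi>) l = theta l * (hat \<phi> l :: 'k::field_char_0)"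
proof -
  obtain f :: "'a set \<Rightarrow> 'k" where nz: "\<exists>S\<in>layer. f S \<noteq> 0"
    and conv_f: "\<And>\<phi> T. T \<in> layer \<Longrightarrow> conv \<phi> f T = hat \<phi> l * f T"
    by (rule eigenfunction[OF assms]) (rule that)
  obtain S where f: "S \<in> layer" "f S \<noteq> 0" using nz by blast
  have "hat (lap \<phi>) l * f S = conv (delta 1) (conv \<phi> f) S"
    by (simp only: conv_delta_1[OF f(1)] conv_f[OF f(1)])
  also have "\<dots> = hat \<phi> l * conv (delta 1) f S"
    by (subst conv_cong[OF conv_f]) (simp_all add: conv_def sum_distrib_left mult_ac)
  also have "\<dots> = theta l * hat \<phi> l * f S"
    using f(1) by (simp add: conv_f theta_def)
  finally show ?thesis using f(2) by simp
qed

lemma eigenseq_ev: "l \<le> m \<Longrightarrow> eigenseq (theta l) (ev l :: nat \<Rightarrow> 'k::field_char_0)"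
  unfolding eigenseq_def hat_def[symmetric] by (intro allI hat_lap)

lemma hat_eq_0D:
  fixes \<phi> :: "nat \<Rightarrow> 'k::field_char_0"
  assumes "\<And>l. l \<le> m \<Longrightarrow> hat \<phi> l = 0" and "t \<le> m"
  shows "\<phi> t = 0"
proof (rule ccontr)
  assume "\<phi> t \<noteq> 0"
  obtain p :: "nat \<Rightarrow> 'k poly" where p: "\<And>t. t \<le> m \<Longrightarrow> degree (p t) = t \<and> p t \<noteq> 0"
    "\<And>t h \<theta>. t \<le> m \<Longrightarrow> eigenseq \<theta> h \<Longrightarrow> h t = h 0 * poly (p t) \<theta>"
    by (rule recurrence_polys) (rule that)
  define q where "q = (\<Sum>t\<le>m. smult (\<phi> t) (p t))"
  have "poly q (theta l) = 0" if "l \<le> m" for l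
  proof -
    have "poly q (theta l) = hat \<phi> l"
      unfolding q_def hat_def poly_sum
    proof (intro sum.cong refl)
      fix t assume "t \<in> {..m}"
      then have "ev l t = poly (p t) (theta l :: 'k)"
        using p(2)[of t, OF _ eigenseq_ev[OF that]] by (simp add: ev_0[OF that])
      then show "poly (smult (\<phi> t) (p t)) (theta l) = \<phi> t * ev l t" by simp
    qed
    then show ?thesis using assms(1)[OF that] by simp
  qed
  then have sub: "theta ` {..m} \<subseteq> {x. poly q x = 0}" by auto
  define M where "M = Max {t. t \<le> m \<and> \<phi> t \<noteq> 0}"
  have ne: "{t. t \<le> m \<and> \<phi> t \<noteq> 0} \<noteq> {}" using assms(2) \<open>\<phi> t \<noteq> 0\<close> by auto
  have fin: "finite {t. t \<le> m \<and> \<phi> t \<noteq> 0}" by simp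
  have M: "M \<le> m" "\<phi> M \<noteq> 0" using Max_in[OF fin ne] by (auto simp: M_def)
  have M_max: "u \<le> M" if "u \<le> m" "\<phi> u \<noteq> 0" for u
    using Max_ge[OF fin] that by (simp add: M_def)
  have "coeff q M = (\<Sum>t\<le>m. if t = M then \<phi> t * coeff (p t) M else 0)"
    unfolding q_def coeff_sum coeff_smult
  proof (intro sum.cong refl)
    fix t assume t: "t \<in> {..m}"
    show "\<phi> t * coeff (p t) M = (if t = M then \<phi> t * coeff (p t) M else 0)"
      using M_max[of t] p(1)[of t] t by (cases "\<phi> t = 0") (auto simp: coeff_eq_0)
  qed
  also have "\<dots> = \<phi> M * lead_coeff (p M)" using M p(1)[of M] by simp
  also have "\<dots> \<noteq> 0" using M p(1)[OF M(1)] by (metis mult_eq_0_iff leading_coeff_0_iff)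
  finally have q: "q \<noteq> 0" by auto
  have "degree q \<le> m"
    unfolding q_def
  proof (rule degree_sum_le)
    fix t assume "t \<in> {..m}"
    then show "degree (smult (\<phi> t) (p t)) \<le> m"
      using degree_smult_le[of "\<phi> t" "p t"] p(1)[of t] by simp
  qed simp
  moreover have "card (theta ` {..m} :: 'k set) = Suc m" by (simp add: card_image theta_inj)
  moreover have "card (theta ` {..m} :: 'k set) \<le> card {x. poly q x = 0}"
    by (intro card_mono sub poly_roots_finite q)
  ultimately show False using card_poly_roots_bound[OF q] by linarith
qed

primrec annih :: "nat \<Rightarrow> nat \<Rightarrow> 'k::comm_ring_1" where
  "annih 0 = delta 0"
| "annih (Suc i) = (\<lambda>u. lap (annih i) u - theta i * annih i u)"

lemma hat_annih:
  "l \<le> m \<Longrightarrow> hat (annih i) l = (\<Prod>j<i. theta l - theta j :: 'k::field_char_0)"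
proof (induction i)
  case 0
  then show ?case by (simp add: hat_delta ev_0)
next
  case (Suc i)
  have "(hat (annih (Suc i)) l :: 'k) = hat (lap (annih i)) l - theta i * hat (annih i) l"
    by (simp add: hat_def sum_subtractf sum_distrib_left algebra_simps)
  then show ?case
    using Suc.IH[OF Suc.prems] hat_lap[OF Suc.prems, of "annih i :: nat \<Rightarrow> 'k"]
    by (simp add: algebra_simps del: annih.simps)
qed

lemma annih_eq_0: "t \<le> m \<Longrightarrow> annih (Suc m) t = (0 :: 'k::field_char_0)"
proof (rule hat_eq_0D)
  fix l assume l: "l \<le> m"
  then show "hat (annih (Suc m)) l = (0 :: 'k)"
    unfolding hat_annih[OF l] by (intro prod_zero) auto
qed

lemma eigenvalue_conv:
  fixes x :: "nat \<Rightarrow> 'k::field_char_0"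
  assumes "S\<^sub>0 \<in> layer" "v S\<^sub>0 \<noteq> 0" and v: "\<And>S. S \<in> layer \<Longrightarrow> conv x v S = e * v S"
  obtains l where "l \<le> m" "e = hat x l"
proof -
  define w where "w i = conv (annih i) v" for i
  have w_Suc: "w (Suc i) S = conv (delta 1) (w i) S - theta i * w i S" if "S \<in> layer" for i S
    unfolding w_def conv_delta_1[OF that]
    by (simp add: conv_def sum_subtractf sum_distrib_left algebra_simps)
  have xw: "S \<in> layer \<Longrightarrow> conv x (w i) S = e * w i S" for i S
  proof (induction i arbitrary: S)
    case 0
    have "w 0 T = v T" if "T \<in> layer" for T using that by (simp add: w_def conv_delta_0)
    then show ?case using v[OF 0] 0 conv_cong[of "w 0" v] by simp
  next
    case (Suc i)
    have "conv x (w (Suc i)) S = conv x (\<lambda>T. conv (delta 1) (w i) T - theta i * w i T) S"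
      by (intro conv_cong w_Suc)
    also have "\<dots> = conv x (conv (delta 1) (w i)) S - theta i * conv x (w i) S"
      by (simp add: conv_def sum_subtractf sum_distrib_left algebra_simps)
    also have "conv x (conv (delta 1) (w i)) S = conv (delta 1) (conv x (w i)) S"
      by (rule conv_delta_1_commute[OF Suc.prems])
    also have "\<dots> = conv (delta 1) (\<lambda>T. e * w i T) S"
      by (intro conv_cong Suc.IH)
    also have "\<dots> = e * conv (delta 1) (w i) S"
      by (simp add: conv_def sum_distrib_left mult_ac)
    finally show ?case
      using Suc by (simp add: w_Suc algebra_simps)
  qed
  have "\<forall>S\<in>layer. w (Suc m) S = 0"
  proof
    fix S assume "S \<in> layer"
    then have "w (Suc m) S = (\<Sum>t\<le>m. annih (Suc m) t * conv (delta t) v S)"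
      unfolding w_def by (rule conv_expand)
    also have "\<dots> = 0"
      by (intro sum.neutral ballI) (simp add: annih_eq_0 del: annih.simps)
    finally show "w (Suc m) S = 0" .
  qed
  moreover have "\<not> (\<forall>S\<in>layer. w 0 S = 0)"
    using assms(1,2) by (auto simp: w_def conv_delta_0)
  ultimately obtain k where k: "k < Suc m" "\<not> (\<forall>S\<in>layer. w k S = 0)" "\<forall>S\<in>layer. w (Suc k) S = 0"
    using ex_least_nat_less[of "\<lambda>i. \<forall>S\<in>layer. w i S = 0" "Suc m"] by auto
  then obtain S where S: "S \<in> layer" "w k S \<noteq> 0" by auto
  have w1: "conv (delta 1) (w k) T = theta k * w k T" if "T \<in> layer" for T
    using w_Suc[OF that, of k] k(3) that by simp
  define h where "h t = conv (delta t) (w k) S" for t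
  have h: "conv \<phi> (w k) S = (\<Sum>t\<le>m. \<phi> t * h t)" for \<phi>
    unfolding h_def by (rule conv_expand[OF S(1)])
  have h_eig: "eigenseq (theta k) h"
    unfolding eigenseq_def
  proof
    fix \<phi>
    have "(\<Sum>u\<le>m. lap \<phi> u * h u) = conv \<phi> (conv (delta 1) (w k)) S"
      by (simp only: h[symmetric] conv_delta_1_commute[OF S(1)] conv_delta_1[OF S(1)])
    also have "\<dots> = conv \<phi> (\<lambda>T. theta k * w k T) S" by (intro conv_cong w1)
    also have "\<dots> = theta k * conv \<phi> (w k) S" by (simp add: conv_def sum_distrib_left mult_ac)
    finally show "(\<Sum>u\<le>m. lap \<phi> u * h u) = theta k * (\<Sum>u\<le>m. \<phi> u * h u)" by (simp only: h)
  qed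
  obtain p :: "nat \<Rightarrow> 'k poly" where "\<And>t. t \<le> m \<Longrightarrow> degree (p t) = t \<and> p t \<noteq> 0"
    and p: "\<And>t h \<theta>. t \<le> m \<Longrightarrow> eigenseq \<theta> h \<Longrightarrow> h t = h 0 * poly (p t) \<theta>"
    by (rule recurrence_polys) (rule that)
  have km: "k \<le> m" using k(1) by linarith
  have h0: "h 0 = w k S" unfolding h_def by (rule conv_delta_0[OF S(1)])
  have "h t = w k S * ev k t" if "t \<le> m" for t
    using p[OF that h_eig] p[OF that eigenseq_ev[OF km]] unfolding h0 ev_0[OF km] by simp
  then have "conv x (w k) S = w k S * hat x k"
    unfolding h hat_def sum_distrib_left by (intro sum.cong) auto
  with xw[OF S(1)] S(2) have "e = hat x k" by simp
  then show thesis by (rule that[OF km])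
qed

end

section \<open>The symmetric diagram matrix\<close>

instance fract :: ("{idom, ring_char_0}") field_char_0
proof
  have of_nat: "of_nat n = to_fract (of_nat n :: 'a)" for n
    by (induction n) simp_all
  show "inj (of_nat :: nat \<Rightarrow> 'a fract)"
    by (auto simp: inj_def of_nat)
qed

lemma to_closure_mult: "to_closure (p * q) = to_closure p * to_closure q"
  by (simp add: to_closure_def)

lemma to_closure_sum: "to_closure (sum f A) = (\<Sum>x\<in>A. to_closure (f x))"
  by (simp add: to_closure_def to_ac_sum)

lemma to_closure_of_int: "to_closure (of_int c) = of_int c"
proof -
  have "to_fract (of_nat n :: cpoly) = of_nat n" for n by (induction n) simp_all
  then show ?thesis by (cases c) (simp_all add: to_closure_def del: of_nat_Suc)
qed

lemma inj_to_closure: "inj to_closure"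
  by (simp add: inj_def to_closure_def)

lemma diagram_eigenvalue_eberlein:
  "diagram_eigenvalue s r l =
     (\<Sum>t\<le>min s r. of_int (eberlein l (int s - int l) (int r - int l) (int t) (int t)) * indet (min s r - t))"
proof -
  have "(\<Sum>j = 0..l. (-1) ^ j * binom (int l) (int j)
      * binom (int s - int l) (int t - int j) * binom (int r - int l) (int t - int j))
      = eberlein l (int s - int l) (int r - int l) (int t) (int t)" for t
    unfolding eberlein_def atLeast0AtMost by (intro sum.cong) (auto simp: binom_def)
  then show ?thesis unfolding diagram_eigenvalue_def atLeast0AtMost by simp
qed

lemma lookup_of_int_indet:
  "Poly_Mapping.lookup (of_int c * indet i) (Poly_Mapping.single j 1) = (if i = j then of_int c else 0)"
proof -
  have "Poly_Mapping.single i (1 :: nat) = Poly_Mapping.single j 1 \<longleftrightarrow> i = j"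
    by (metis lookup_single_eq lookup_single_not_eq zero_neq_one)
  then show ?thesis
    by (simp add: indet_def lookup_single mult_single flip: single_of_int)
qed

lemma inj_on_diagram_eigenvalue: "inj_on (diagram_eigenvalue s r) {..min s r}"
proof (cases "min s r = 0")
  case True
  then show ?thesis by (auto simp: inj_on_def)
next
  case False
  have "Poly_Mapping.lookup (diagram_eigenvalue s r l) (Poly_Mapping.single (min s r - 1) 1)
      = of_int (eberlein l (int s - int l) (int r - int l) 1 1)" for l
  proof -
    have "min s r - t = min s r - 1 \<longleftrightarrow> t = 1" if "t \<le> min s r" for t
      using that False by linarith
    then have "Poly_Mapping.lookup (diagram_eigenvalue s r l) (Poly_Mapping.single (min s r - 1) 1)
        = (\<Sum>t\<le>min s r. if t = 1 then of_int (eberlein l (int s - int l) (int r - int l) (int t) (int t)) else 0)"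
      unfolding diagram_eigenvalue_eberlein lookup_sum lookup_of_int_indet by (intro sum.cong) auto
    then show ?thesis using False by (simp add: Suc_le_eq)
  qed
  then show ?thesis
    using eberlein_one_one_inj[of s r] unfolding inj_on_def by (metis of_int_eq_iff)
qed

theorem theorem3p9:
  fixes s r k :: nat
    and P :: "nat set set"
    and ds :: "(nat + nat) set set list"
  assumes "partition_on {1..k} P"
    and "card P = s + r"
    and "distinct ds"
    and "set ds = diagrams s P"
  shows "{e. eigenvalue (map_mat to_closure (diagram_matrix s r P ds)) e}
           = (\<lambda>l. to_closure (diagram_eigenvalue s r l)) ` {0..min s r}
         \<and> inj_on (\<lambda>l. to_closure (diagram_eigenvalue s r l)) {0..min s r}"
proof
  have empty: "{} \<notin> P" using assms(1) by (auto simp: partition_on_def)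
  interpret johnson P s r
    by standard (use assms(1,2) finite_elements in auto)
  define N where "N = length ds"
  define St where "St i = through_classes P (ds ! i)" for i
  define x where "x t = to_closure (indet (min s r - t))" for t
  define M where "M = map_mat to_closure (diagram_matrix s r P ds)"
  have "bij_betw (through_classes P) (diagrams s P) layer"
  proof (rule bij_betw_byWitness[where f' = "diagram P"])
    show "\<forall>d\<in>diagrams s P. diagram P (through_classes P d) = d"
      "\<forall>S\<in>layer. through_classes P (diagram P S) = S"
      "through_classes P ` diagrams s P \<subseteq> layer" "diagram P ` layer \<subseteq> diagrams s P"
      using empty by (auto simp: diagrams_def layer_def through_classes_diagram)
  qed
  then have "bij_betw (through_classes P \<circ> (!) ds) {..<N} layer"
    using assms(3,4) by (intro bij_betw_trans[of _ _ "set ds"] bij_betw_nth) (auto simp: N_def)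
  then have bij: "bij_betw St {..<N} layer" by (simp add: St_def[abs_def] comp_def)
  have St: "ds ! i = diagram P (St i)" "St i \<subseteq> P" if "i < N" for i
  proof -
    have "ds ! i \<in> diagrams s P" using nth_mem[of i ds] that unfolding N_def assms(4) .
    then obtain S where "S \<subseteq> P" "ds ! i = diagram P S" by (auto simp: diagrams_def)
    then show "ds ! i = diagram P (St i)" "St i \<subseteq> P"
      using empty by (simp_all add: St_def through_classes_diagram)
  qed
  have dim: "dim_row M = N" "dim_col M = N" by (simp_all add: M_def diagram_matrix_def N_def)
  have entry: "M $$ (i, j) = x (card (St j - St i))" if "i < N" "j < N" for i j
    using that empty St by (simp add: M_def diagram_matrix_def N_def x_def replaced_diagram)
  have mult: "(M *\<^sub>v v) $ i = conv x g (St i)"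
    if "i < N" "dim_vec v = N" "\<And>j. j < N \<Longrightarrow> v $ j = g (St j)" for v :: "cpoly_closure vec" and g i
  proof -
    have "(M *\<^sub>v v) $ i = (\<Sum>j<N. M $$ (i, j) * v $ j)"
      using that(1,2) dim by (simp add: scalar_prod_def lessThan_atLeast0)
    also have "\<dots> = (\<Sum>j<N. x (card (St j - St i)) * g (St j))"
      using that by (intro sum.cong) (auto simp: entry)
    also have "\<dots> = conv x g (St i)"
      unfolding conv_def by (rule sum.reindex_bij_betw[OF bij])
    finally show ?thesis .
  qed
  have hat: "to_closure (diagram_eigenvalue s r l) = hat x l" for l
    by (simp add: diagram_eigenvalue_eberlein to_closure_sum to_closure_mult to_closure_of_int hat_def
        ev_def x_def mult.commute)
  show "{e. eigenvalue (map_mat to_closure (diagram_matrix s r P ds)) e}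
           = (\<lambda>l. to_closure (diagram_eigenvalue s r l)) ` {0..min s r}"
    unfolding M_def[symmetric] hat
  proof (intro equalityI subsetI)
    fix e assume "e \<in> {e. eigenvalue M e}"
    then obtain v where "eigenvector M v e" by (auto simp: eigenvalue_def)
    then have v: "dim_vec v = N" "v \<noteq> 0\<^sub>v N" "M *\<^sub>v v = e \<cdot>\<^sub>v v"
      unfolding eigenvector_def dim by (blast intro: carrier_vecD)+
    define g where "g S = vec_index v (inv_into {..<N} St S)" for S
    have g: "v $ j = g (St j)" if "j < N" for j
      using bij that by (simp add: g_def bij_betw_def inv_into_f_f)
    obtain i where i: "i < N" "v $ i \<noteq> 0"
      using v(1,2) by (metis eq_vecI index_zero_vec)
    have "conv x g S = e * g S" if S: "S \<in> layer" for S
    proof -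
      obtain j where j: "j < N" "S = St j" using S bij by (auto simp: bij_betw_def)
      have "conv x g (St j) = (M *\<^sub>v v) $ j" using mult[OF j(1) v(1) g] by simp
      also have "\<dots> = e * g (St j)" using v(1,3) j(1) g by simp
      finally show ?thesis using j by simp
    qed
    moreover have "St i \<in> layer" "g (St i) \<noteq> 0" using i g bij by (auto simp: bij_betw_def)
    ultimately obtain l where "l \<le> min s r" "e = hat x l"
      using eigenvalue_conv[of "St i" g x e] by blast
    then show "e \<in> hat x ` {0..min s r}" by auto
  next
    fix e assume "e \<in> hat x ` {0..min s r}"
    then obtain l where l: "l \<le> min s r" "e = hat x l" by auto
    obtain f :: "nat set set \<Rightarrow> cpoly_closure" where nz: "\<exists>S\<in>layer. f S \<noteq> 0"
      and f: "\<And>\<phi> T. T \<in> layer \<Longrightarrow> conv \<phi> f T = hat \<phi> l * f T"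
      by (rule eigenfunction[OF l(1)]) (rule that)
    define v where "v = vec N (\<lambda>i. f (St i))"
    obtain i where i: "i < N" "f (St i) \<noteq> 0" using nz unfolding bij_betw_imp_surj_on[OF bij, symmetric] by auto
    have "v \<noteq> 0\<^sub>v N"
    proof
      assume "v = 0\<^sub>v N"
      then have "v $ i = 0" using i(1) by simp
      then show False using i by (simp add: v_def)
    qed
    moreover have "M *\<^sub>v v = e \<cdot>\<^sub>v v"
    proof (rule eq_vecI)
      fix j assume "j < dim_vec (e \<cdot>\<^sub>v v)"
      then have j: "j < N" by (simp add: v_def)
      then have "St j \<in> layer" using bij by (auto simp: bij_betw_def)
      have "(M *\<^sub>v v) $ j = conv x f (St j)" by (rule mult[OF j]) (simp_all add: v_def)
      also have "\<dots> = e * f (St j)" unfolding l(2) by (rule f) fact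
      finally show "(M *\<^sub>v v) $ j = (e \<cdot>\<^sub>v v) $ j" using j by (simp add: v_def)
    qed (simp add: dim v_def)
    moreover have "v \<in> carrier_vec N" by (simp add: v_def)
    ultimately show "e \<in> {e. eigenvalue M e}"
      by (auto simp: eigenvalue_def eigenvector_def dim)
  qed
  show "inj_on (\<lambda>l. to_closure (diagram_eigenvalue s r l)) {0..min s r}"
    using inj_on_diagram_eigenvalue[of s r] inj_to_closure
    by (auto simp: inj_on_def atLeast0AtMost)
qed

end
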